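(* In the downlink NOMA model of the context, assume $a_m>\varepsilon_m a_n$ and $a_n>\varepsilon_n a_m$. Let $P_m(\rho)=\Pr(\gamma_m<\varepsilon_m)$, and let $P_{\tilde n}(\rho)$, $\tilde n\in\{n1,n2\}$, be either of the outage probabilities of the $n$-th user $$P_{n1}=\Pr\{\gamma_{n\to m}\le\varepsilon_m\}+\Pr\{\gamma_{n\to m}>\varepsilon_m,\gamma_n\le\varepsilon_n\},$$ $$P_{n2}=\Pr\{\gamma_{n\to m}\le\varepsilon_m,\gamma_{n\to n}\le\varepsilon_n\}+\Pr\{\gamma_{n\to m}>\varepsilon_m,\gamma_n\le\varepsilon_n\}.$$ Let the outage probability of the user pair be $P_{nm}(\rho)=1-(1-P_m(\rho))(1-P_{\tilde n}(\rho))$. Then the diversity order of $P_{nm}$ is: with imperfect SIC ($\varpi=1$), $0$ for both CD-NOMA ($K\ne1$) and PD-NOMA ($K=1$); with perfect SIC ($\varpi=0$), $mK$ for CD-NOMA and $m$ for PD-NOMA.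
   Context: Fix integers $M>K\ge 1$ and $1\le m<n\le M$, reals $\eta,\alpha,R_D,\Omega_I>0$, power coefficients $a_m>a_n>0$ with $a_m+a_n=1$, and target rates $R_m,R_n>0$ with $\varepsilon_m=2^{R_m}-1$, $\varepsilon_n=2^{R_n}-1$; $\rho>0$ is the transmit SNR. $M$ users are placed independently and uniformly in a disc of radius $R_D$ centred at the base station. A user at distance $d$ from the centre has channel vector in $\mathbb{C}^K$ with entries $\sqrt{\eta}\,h_k/\sqrt{1+d^\alpha}$, $k=1,\dots,K$, where the $h_k$ are i.i.d. $\mathcal{CN}(0,1)$ (circularly symmetric, $\mathbb{E}|h_k|^2=1$), independent across users and of the locations. Users are relabelled so that their channel vectors satisfy $\|\mathbf h_1\|_2^2<\dots<\|\mathbf h_M\|_2^2$. The signals of users $m$ and $n$ are spread over the $K$ subcarriers by indicator vectors $\mathbf g_m,\mathbf g_n\in\{0,1\}^K$ of the same weight, all $K$ subcarriers being occupied, so for $\varphi\in\{m,n\}$ one has $\|\mathrm{diag}(\mathbf h_\varphi)\mathbf g_m\|_2^2=\|\mathrm{diag}(\mathbf h_\varphi)\mathbf g_n\|_2^2=\|\mathbf h_\varphi\|_2^2=:Z_\varphi$. The residual interference vector $\mathbf h_I$ has $K$ i.i.d. $\mathcal{CN}(0,\Omega_I)$ entries, independent of everything else, and $Y_I=\|\mathbf h_I\|_2^2$. SINRs: $\gamma_m=\frac{\rho Z_m a_m}{\rho Z_m a_n+1}$, $\gamma_{n\to m}=\frac{\rho Z_n a_m}{\rho Z_n a_n+1}$,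 $\gamma_n=\frac{\rho Z_n a_n}{\varpi\rho Y_I+1}$, $\gamma_{n\to n}=\frac{\rho Z_n a_n}{\rho Z_n a_m+1}$. Diversity order of an outage probability $P(\rho)$: $d=-\lim_{\rho\to\infty}\frac{\log P^\infty(\rho)}{\log\rho}$, where $P^\infty$ is the asymptotic outage probability at high SNR, i.e. $P(\rho)/P^\infty(\rho)\to1$ as $\rho\to\infty$. *)

theory Defs
  imports "HOL-Probability.Probability"
begin

section \<open>Complex Gaussian and uniform laws\<close>

text \<open>Real and imaginary part are independent centred normals of variance \<open>v / 2\<close> each,
  so that the second absolute moment is \<open>v\<close>.  The third argument of \<^const>\<open>normal_density\<close> is the
  evaluation point, the second one the standard deviation.\<close>

definition complex_normal :: "real \<Rightarrow> complex measure" where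
  "complex_normal v = density lborel
     (\<lambda>z. ennreal (normal_density 0 (sqrt (v / 2)) (Re z) * normal_density 0 (sqrt (v / 2)) (Im z)))"

text \<open>The plane of user locations is identified with the complex plane, the base station being
  at the origin.\<close>

definition uniform_disc :: "real \<Rightarrow> complex measure" where
  "uniform_disc r = uniform_measure lborel (cball 0 r)"

section \<open>Sources of randomness\<close>

text \<open>All elementary random variables are complex valued, so their joint independence can be
  expressed for a single indexed family.\<close>

datatype source = Location nat | Fading nat nat | Interference nat

primrec source_var ::
  "(nat \<Rightarrow> 'w \<Rightarrow> complex) \<Rightarrow> (nat \<Rightarrow> nat \<Rightarrow> 'w \<Rightarrow> complex) \<Rightarrow> (nat \<Rightarrow> 'w \<Rightarrow> complex)
    \<Rightarrow> source \<Rightarrow> 'w \<Rightarrow> complex" where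
  "source_var pos h hI (Location i) = pos i"
| "source_var pos h hI (Fading i k) = h i k"
| "source_var pos h hI (Interference k) = hI k"

definition sources :: "nat \<Rightarrow> nat \<Rightarrow> source set" where
  "sources M K = Location ` {1..M} \<union> (\<lambda>(i, k). Fading i k) ` ({1..M} \<times> {1..K})
     \<union> Interference ` {1..K}"

section \<open>Channels\<close>

definition norm_sq :: "nat \<Rightarrow> (nat \<Rightarrow> complex) \<Rightarrow> real" where
  "norm_sq K v = (\<Sum>k = 1..K. (cmod (v k))\<^sup>2)"

definition channel ::
  "real \<Rightarrow> real \<Rightarrow> (nat \<Rightarrow> 'w \<Rightarrow> complex) \<Rightarrow> (nat \<Rightarrow> nat \<Rightarrow> 'w \<Rightarrow> complex)
    \<Rightarrow> nat \<Rightarrow> 'w \<Rightarrow> nat \<Rightarrow> complex" where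
  "channel \<eta> \<alpha> pos h i \<omega> k =
     of_real (sqrt \<eta>) * h i k \<omega> / of_real (sqrt (1 + cmod (pos i \<omega>) powr \<alpha>))"

text \<open>\<open>user_at M K c \<phi> \<omega>\<close> is the original index of the user that carries label \<open>\<phi>\<close> after sorting
  by channel gain.  Ties, which form a null event for continuous gains, are broken by the original
  index; hence labels are defined at every sample point.\<close>

definition user_at :: "nat \<Rightarrow> nat \<Rightarrow> (nat \<Rightarrow> 'w \<Rightarrow> nat \<Rightarrow> complex) \<Rightarrow> nat \<Rightarrow> 'w \<Rightarrow> nat" where
  "user_at M K c \<phi> \<omega> = sort_key (\<lambda>i. norm_sq K (c i \<omega>)) [1..<Suc M] ! (\<phi> - 1)"

definition ordered_channel ::
  "nat \<Rightarrow> nat \<Rightarrow> (nat \<Rightarrow> 'w \<Rightarrow> nat \<Rightarrow> complex) \<Rightarrow> nat \<Rightarrow> 'w \<Rightarrow> nat \<Rightarrow> complex" where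
  "ordered_channel M K c \<phi> \<omega> = c (user_at M K c \<phi> \<omega>) \<omega>"

definition diag_mult :: "(nat \<Rightarrow> complex) \<Rightarrow> (nat \<Rightarrow> nat) \<Rightarrow> nat \<Rightarrow> complex" where
  "diag_mult v g k = v k * of_nat (g k)"

lemma bij_betw_user_at: "bij_betw (\<lambda>\<phi>. user_at M K c \<phi> \<omega>) {1..M} {1..M}"
proof -
  let ?xs = "sort_key (\<lambda>i. norm_sq K (c i \<omega>)) [1..<Suc M]"
  have "bij_betw ((!) ?xs) {..<M} {1..M}"
    by (rule bij_betw_nth) auto
  moreover have "bij_betw (\<lambda>\<phi>. \<phi> - 1) {1..M} {..<M}"
    by (rule bij_betwI[where g = Suc]) auto
  ultimately have "bij_betw ((!) ?xs \<circ> (\<lambda>\<phi>. \<phi> - 1)) {1..M} {1..M}"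
    by (metis bij_betw_trans)
  then show ?thesis by (simp add: user_at_def comp_def)
qed

lemma norm_sq_ordered_channel_mono:
  assumes "1 \<le> \<phi>" "\<phi> \<le> \<psi>" "\<psi> \<le> M"
  shows "norm_sq K (ordered_channel M K c \<phi> \<omega>) \<le> norm_sq K (ordered_channel M K c \<psi> \<omega>)"
proof -
  let ?f = "\<lambda>i. norm_sq K (c i \<omega>)"
  let ?xs = "sort_key ?f [1..<Suc M]"
  have "map ?f ?xs ! (\<phi> - 1) \<le> map ?f ?xs ! (\<psi> - 1)"
    by (rule sorted_nth_mono) (use assms in auto)
  moreover have "\<phi> - 1 < length ?xs" "\<psi> - 1 < length ?xs"
    using assms by auto
  ultimately show ?thesis
    by (simp add: ordered_channel_def user_at_def del: upt_Suc)
qed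

lemma norm_sq_diag_mult:
  assumes "\<And>k. k \<in> {1..K} \<Longrightarrow> g k = 1"
  shows "norm_sq K (diag_mult v g) = norm_sq K v"
  using assms by (simp add: norm_sq_def diag_mult_def)

section \<open>SINRs and outage probabilities\<close>

definition sinr_m :: "real \<Rightarrow> real \<Rightarrow> real \<Rightarrow> real \<Rightarrow> real" where
  "sinr_m a\<^sub>m a\<^sub>n \<rho> z\<^sub>m = \<rho> * z\<^sub>m * a\<^sub>m / (\<rho> * z\<^sub>m * a\<^sub>n + 1)"

definition sinr_nm :: "real \<Rightarrow> real \<Rightarrow> real \<Rightarrow> real \<Rightarrow> real" where
  "sinr_nm a\<^sub>m a\<^sub>n \<rho> z\<^sub>n = \<rho> * z\<^sub>n * a\<^sub>m / (\<rho> * z\<^sub>n * a\<^sub>n + 1)"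

text \<open>The argument \<open>\<xi>\<close> is the SIC parameter: 1 for imperfect and 0 for perfect SIC.\<close>

definition sinr_n :: "real \<Rightarrow> real \<Rightarrow> real \<Rightarrow> real \<Rightarrow> real \<Rightarrow> real" where
  "sinr_n \<xi> a\<^sub>n \<rho> z\<^sub>n y = \<rho> * z\<^sub>n * a\<^sub>n / (\<xi> * \<rho> * y + 1)"

definition sinr_nn :: "real \<Rightarrow> real \<Rightarrow> real \<Rightarrow> real \<Rightarrow> real" where
  "sinr_nn a\<^sub>m a\<^sub>n \<rho> z\<^sub>n = \<rho> * z\<^sub>n * a\<^sub>n / (\<rho> * z\<^sub>n * a\<^sub>m + 1)"

definition outage_m ::
  "'w measure \<Rightarrow> real \<Rightarrow> real \<Rightarrow> real \<Rightarrow> ('w \<Rightarrow> real) \<Rightarrow> real \<Rightarrow> real" where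
  "outage_m W a\<^sub>m a\<^sub>n \<epsilon>\<^sub>m Z\<^sub>m \<rho> = measure W {\<omega> \<in> space W. sinr_m a\<^sub>m a\<^sub>n \<rho> (Z\<^sub>m \<omega>) < \<epsilon>\<^sub>m}"

definition outage_n1 ::
  "'w measure \<Rightarrow> real \<Rightarrow> real \<Rightarrow> real \<Rightarrow> real \<Rightarrow> ('w \<Rightarrow> real) \<Rightarrow> ('w \<Rightarrow> real) \<Rightarrow> real \<Rightarrow> real \<Rightarrow> real"
  where
  "outage_n1 W a\<^sub>m a\<^sub>n \<epsilon>\<^sub>m \<epsilon>\<^sub>n Z\<^sub>n Y\<^sub>I \<xi> \<rho> =
     measure W {\<omega> \<in> space W. sinr_nm a\<^sub>m a\<^sub>n \<rho> (Z\<^sub>n \<omega>) \<le> \<epsilon>\<^sub>m}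
   + measure W {\<omega> \<in> space W. sinr_nm a\<^sub>m a\<^sub>n \<rho> (Z\<^sub>n \<omega>) > \<epsilon>\<^sub>m \<and> sinr_n \<xi> a\<^sub>n \<rho> (Z\<^sub>n \<omega>) (Y\<^sub>I \<omega>) \<le> \<epsilon>\<^sub>n}"

definition outage_n2 ::
  "'w measure \<Rightarrow> real \<Rightarrow> real \<Rightarrow> real \<Rightarrow> real \<Rightarrow> ('w \<Rightarrow> real) \<Rightarrow> ('w \<Rightarrow> real) \<Rightarrow> real \<Rightarrow> real \<Rightarrow> real"
  where
  "outage_n2 W a\<^sub>m a\<^sub>n \<epsilon>\<^sub>m \<epsilon>\<^sub>n Z\<^sub>n Y\<^sub>I \<xi> \<rho> =
     measure W {\<omega> \<in> space W. sinr_nm a\<^sub>m a\<^sub>n \<rho> (Z\<^sub>n \<omega>) \<le> \<epsilon>\<^sub>m \<and> sinr_nn a\<^sub>m a\<^sub>n \<rho> (Z\<^sub>n \<omega>) \<le> \<epsilon>\<^sub>n}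
   + measure W {\<omega> \<in> space W. sinr_nm a\<^sub>m a\<^sub>n \<rho> (Z\<^sub>n \<omega>) > \<epsilon>\<^sub>m \<and> sinr_n \<xi> a\<^sub>n \<rho> (Z\<^sub>n \<omega>) (Y\<^sub>I \<omega>) \<le> \<epsilon>\<^sub>n}"

definition outage_pair :: "(real \<Rightarrow> real) \<Rightarrow> (real \<Rightarrow> real) \<Rightarrow> real \<Rightarrow> real" where
  "outage_pair P\<^sub>m P\<^sub>n \<rho> = 1 - (1 - P\<^sub>m \<rho>) * (1 - P\<^sub>n \<rho>)"

section \<open>Diversity order\<close>

text \<open>The plain ratio is used instead of \<open>asymp_equiv\<close>, which treats 0 / 0 as 1 and would admit
  functions that vanish.\<close>

definition has_diversity_order :: "(real \<Rightarrow> real) \<Rightarrow> real \<Rightarrow> bool" where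
  "has_diversity_order P d \<longleftrightarrow>
     (\<exists>P\<^sub>i\<^sub>n\<^sub>f. ((\<lambda>\<rho>. P \<rho> / P\<^sub>i\<^sub>n\<^sub>f \<rho>) \<longlongrightarrow> 1) at_top
          \<and> ((\<lambda>\<rho>. - (ln (P\<^sub>i\<^sub>n\<^sub>f \<rho>) / ln \<rho>)) \<longlongrightarrow> d) at_top)"

end

(* Each outage probability is sandwiched between constant multiples of the same power of \<rho>, so it
   can serve as its own asymptotic form P^\<infinity> and exact distributions are never needed.
   The m-th smallest gain is below x iff some m users have gains below x. The gains of a fixed
   set of m users are all below x with probability of order x^(mK): a gain is comparable to the
   squared norm of its K fading coefficients because the location stays in a bounded disc, and each
   coefficient has a density bounded above and, near 0, below. A union bound over the m-subsets
   gives the upper estimate. Under perfect SIC, every outage event forces an m-th gain of order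
   1/\<rho>. Under imperfect SIC, the event that the interference dominates the n-th gain, while that gain
   stays away from 0, has positive probability not depending on \<rho> and lies in the outage event for
   all large \<rho>. *)
theory Submission imports Defs begin

section \<open>Complex normal and uniform laws\<close>

text \<open>Both coordinates have variance \<open>v / 2\<close>, so the exponents add up to the
  squared modulus over \<open>v\<close>. The density is therefore radial and decreasing in the
  modulus, which is all that the estimates below exploit.\<close>

lemma normal_density_Re_Im:
  assumes "v > 0"
  shows "normal_density 0 (sqrt (v / 2)) (Re z) * normal_density 0 (sqrt (v / 2)) (Im z)
    = exp (- (cmod z)\<^sup>2 / v) / (pi * v)"
  using assms
  by (simp add: normal_density_def cmod_power2 exp_add[symmetric] field_simps real_sqrt_mult)

lemma emeasure_complex_normal:
  assumes "v > 0" and "A \<in> sets borel"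
  shows "emeasure (complex_normal v) A
    = (\<integral>\<^sup>+z\<in>A. ennreal (exp (- (cmod z)\<^sup>2 / v) / (pi * v)) \<partial>lborel)"
  unfolding complex_normal_def using assms
  by (simp add: emeasure_density normal_density_Re_Im)

text \<open>The radial density peaks at the origin with value \<open>1 / (pi * v)\<close>.\<close>

lemma emeasure_complex_normal_le:
  assumes "v > 0" and A: "A \<in> sets borel"
  shows "emeasure (complex_normal v) A \<le> ennreal (1 / (pi * v)) * emeasure lborel A"
proof -
  have "emeasure (complex_normal v) A \<le> (\<integral>\<^sup>+z\<in>A. ennreal (1 / (pi * v)) \<partial>lborel)"
    unfolding emeasure_complex_normal[OF assms]
    using \<open>v > 0\<close> by (intro nn_integral_mono mult_right_mono ennreal_leI divide_right_mono) auto
  also have "\<dots> = ennreal (1 / (pi * v)) * emeasure lborel A"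
    using A by (simp add: nn_integral_cmult_indicator)
  finally show ?thesis .
qed

text \<open>On a disc about the origin the radial density is smallest on the boundary
  circle.\<close>

lemma emeasure_complex_normal_ge:
  assumes "v > 0" and A: "A \<in> sets borel" and "A \<subseteq> cball 0 r"
  shows "ennreal (exp (- r\<^sup>2 / v) / (pi * v)) * emeasure lborel A \<le> emeasure (complex_normal v) A"
proof -
  have "ennreal (exp (- r\<^sup>2 / v) / (pi * v)) * emeasure lborel A
      = (\<integral>\<^sup>+z\<in>A. ennreal (exp (- r\<^sup>2 / v) / (pi * v)) \<partial>lborel)"
    using A by (simp add: nn_integral_cmult_indicator)
  also have "\<dots> \<le> emeasure (complex_normal v) A"
    unfolding emeasure_complex_normal[OF \<open>v > 0\<close> A]
  proof (intro nn_integral_mono)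
    fix z
    have "exp (- r\<^sup>2 / v) / (pi * v) \<le> exp (- (cmod z)\<^sup>2 / v) / (pi * v)" if "z \<in> A"
    proof -
      have "cmod z \<le> r" using that assms(3) by auto
      then have "(cmod z)\<^sup>2 \<le> r\<^sup>2" by (simp add: power_mono)
      then show ?thesis
        using \<open>v > 0\<close> by (intro divide_right_mono) (auto simp: divide_right_mono)
    qed
    then show "ennreal (exp (- r\<^sup>2 / v) / (pi * v)) * indicator A z
      \<le> ennreal (exp (- (cmod z)\<^sup>2 / v) / (pi * v)) * indicator A z"
      by (auto simp: indicator_def intro: ennreal_leI)
  qed
  finally show ?thesis .
qed

text \<open>A small ball inside \<open>U\<close> lies in some disc about the origin, where the
  density is bounded below by a positive constant.\<close>

lemma emeasure_complex_normal_open_pos: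
  assumes "v > 0" and "open U" and "U \<noteq> {}"
  shows "emeasure (complex_normal v) U > 0"
proof -
  obtain z e where e: "e > 0" "ball z e \<subseteq> U"
    using assms(2,3) by (meson ex_in_conv openE)
  have "ball z e \<subseteq> cball 0 (cmod z + e)"
  proof
    fix w assume "w \<in> ball z e"
    then show "w \<in> cball 0 (cmod z + e)"
      using norm_triangle_ineq2[of w z] by (simp add: dist_norm norm_minus_commute)
  qed
  then have "ennreal (exp (- (cmod z + e)\<^sup>2 / v) / (pi * v)) * emeasure lborel (ball z e)
      \<le> emeasure (complex_normal v) (ball z e)"
    using \<open>v > 0\<close> by (intro emeasure_complex_normal_ge) auto
  also have "\<dots> \<le> emeasure (complex_normal v) U"
    using e \<open>open U\<close> by (intro emeasure_mono) (auto simp: complex_normal_def)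
  finally have "ennreal (exp (- (cmod z + e)\<^sup>2 / v) / (pi * v)) * emeasure lborel (ball z e)
      \<le> emeasure (complex_normal v) U" .
  moreover have "0 < ennreal (exp (- (cmod z + e)\<^sup>2 / v) / (pi * v)) * emeasure lborel (ball z e)"
    using \<open>v > 0\<close> e(1) by (simp add: emeasure_ball unit_ball_vol_2 flip: ennreal_mult)
  ultimately show ?thesis by (rule order_less_le_trans[rotated])
qed

text \<open>The area \<open>pi * r\<^sup>2\<close> cancels the normalisation \<open>1 / pi\<close>
  of the density. The two bounds differ only by the factor \<open>exp (- r\<^sup>2)\<close>, so for
  small \<open>r\<close> the probability has exact order \<open>r\<^sup>2\<close>.\<close>

lemma measure_complex_normal_ball:
  assumes "r \<ge> 0"
  shows "measure (complex_normal 1) (ball 0 r) \<le> r\<^sup>2"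
    and "exp (- r\<^sup>2) * r\<^sup>2 \<le> measure (complex_normal 1) (ball 0 r)"
proof -
  have upper: "emeasure (complex_normal 1) (ball 0 r) \<le> ennreal (r\<^sup>2)"
    using emeasure_complex_normal_le[of 1 "ball 0 r"] assms
    by (simp add: emeasure_ball unit_ball_vol_2 flip: ennreal_mult)
  then show "measure (complex_normal 1) (ball 0 r) \<le> r\<^sup>2"
    unfolding measure_def by (intro enn2real_leI) auto
  have "ennreal (exp (- r\<^sup>2) * r\<^sup>2) \<le> emeasure (complex_normal 1) (ball 0 r)"
    using emeasure_complex_normal_ge[of 1 "ball 0 r" r] assms
    by (simp add: emeasure_ball unit_ball_vol_2 ball_subset_cball flip: ennreal_mult)
  \<comment> \<open>Finiteness, needed to pass to a real measure, comes from the upper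
    bound.\<close>
  also have "\<dots> = ennreal (measure (complex_normal 1) (ball 0 r))"
    using upper by (intro emeasure_eq_ennreal_measure) (auto simp: top_unique)
  finally show "exp (- r\<^sup>2) * r\<^sup>2 \<le> measure (complex_normal 1) (ball 0 r)"
    by simp
qed

lemma emeasure_uniform_disc_cball:
  assumes "r > 0"
  shows "emeasure (uniform_disc r) (cball 0 r) = 1"
proof -
  have "emeasure lborel (cball (0::complex) r) = ennreal (pi * r\<^sup>2)"
    using assms by (simp add: emeasure_cball unit_ball_vol_2)
  then show ?thesis
    unfolding uniform_disc_def using assms
    by (simp add: divide_ennreal)
qed

section \<open>Order statistics of the channel gains\<close>

text \<open>This trades sorting for a condition on sets of users. Forwards, the carriers of labels 1
  to \<phi> form the set; backwards, \<phi> users cannot share the \<phi> - 1 labels below \<phi>.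
  Ties do no harm.\<close>

lemma norm_sq_ordered_channel_less_iff:
  assumes "1 \<le> \<phi>" and "\<phi> \<le> M"
  shows "norm_sq K (ordered_channel M K c \<phi> \<omega>) < x
    \<longleftrightarrow> (\<exists>S \<subseteq> {1..M}. card S = \<phi> \<and> (\<forall>i\<in>S. norm_sq K (c i \<omega>) < x))"
    (is "?Z \<phi> < x \<longleftrightarrow> ?R")
proof -
  let ?u = "\<lambda>\<psi>. user_at M K c \<psi> \<omega>"
  have bij: "bij_betw ?u {1..M} {1..M}" by (rule bij_betw_user_at)
  show ?thesis
  proof
    assume less: "?Z \<phi> < x"
    have "?u ` {1..\<phi>} \<subseteq> {1..M}"
      using bij_betw_imp_surj_on[OF bij] assms by fastforce
    moreover have "card (?u ` {1..\<phi>}) = \<phi>"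
      using bij_betw_imp_inj_on[OF bij] assms by (subst card_image) (auto intro: inj_on_subset)
    moreover have "norm_sq K (c (?u \<psi>) \<omega>) < x" if "\<psi> \<in> {1..\<phi>}" for \<psi>
      using norm_sq_ordered_channel_mono[of \<psi> \<phi> M K c \<omega>] that assms less
      by (simp add: ordered_channel_def)
    ultimately show ?R by (intro exI[of _ "?u ` {1..\<phi>}"]) auto
  next
    assume ?R
    then obtain S where S: "S \<subseteq> {1..M}" "card S = \<phi>" "\<And>i. i \<in> S \<Longrightarrow> norm_sq K (c i \<omega>) < x"
      by auto
    show "?Z \<phi> < x"
    proof (rule ccontr)
      assume "\<not> ?Z \<phi> < x"
      \<comment> \<open>If the value at label \<phi> is at least \<open>x\<close>, so are all values
        at higher labels, which pushes every user of \<open>S\<close> to a smaller label.\<close>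
      have "S \<subseteq> ?u ` {1..<\<phi>}"
      proof
        fix i assume "i \<in> S"
        then obtain \<psi> where \<psi>: "\<psi> \<in> {1..M}" "i = ?u \<psi>"
          using S(1) bij_betw_imp_surj_on[OF bij] by blast
        have "\<psi> < \<phi>"
          using norm_sq_ordered_channel_mono[of \<phi> \<psi> M K c \<omega>] S(3)[OF \<open>i \<in> S\<close>] \<psi> assms
            \<open>\<not> ?Z \<phi> < x\<close>
          by (force simp: ordered_channel_def)
        then show "i \<in> ?u ` {1..<\<phi>}" using \<psi> by auto
      qed
      then have "card S \<le> card {1..<\<phi>}"
        by (meson card_image_le card_mono finite_atLeastLessThan finite_imageI le_trans)
      then show False using S(2) assms by simp
    qed
  qed
qed

section \<open>The random channel model\<close>

text \<open>Only the probabilistic data of the model are collected here; power coefficients, rates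
  and SNR enter later. \<open>R\<close> is the disc radius and \<open>v\<close> the interference
  variance.\<close>

locale noma_channel = prob_space W for W :: "'w measure" +
  fixes M K :: nat and \<eta> \<alpha> R v :: real
    and pos :: "nat \<Rightarrow> 'w \<Rightarrow> complex"
    and h :: "nat \<Rightarrow> nat \<Rightarrow> 'w \<Rightarrow> complex"
    and hI :: "nat \<Rightarrow> 'w \<Rightarrow> complex"
  assumes K_pos: "1 \<le> K" and \<eta>_pos: "\<eta> > 0" and \<alpha>_pos: "\<alpha> > 0" and R_pos: "R > 0" and v_pos: "v > 0"
    and independent: "indep_vars (\<lambda>_. borel) (source_var pos h hI) (sources M K)"
    and locations: "\<And>i. i \<in> {1..M} \<Longrightarrow> distr W borel (pos i) = uniform_disc R"
    and fading: "\<And>i k. i \<in> {1..M} \<Longrightarrow> k \<in> {1..K} \<Longrightarrow> distr W borel (h i k) = complex_normal 1"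
    and interference: "\<And>k. k \<in> {1..K} \<Longrightarrow> distr W borel (hI k) = complex_normal v"
begin

definition gain :: "nat \<Rightarrow> 'w \<Rightarrow> real" where
  "gain i \<omega> = norm_sq K (channel \<eta> \<alpha> pos h i \<omega>)"

definition ordered_gain :: "nat \<Rightarrow> 'w \<Rightarrow> real" where
  "ordered_gain \<phi> \<omega> = norm_sq K (ordered_channel M K (channel \<eta> \<alpha> pos h) \<phi> \<omega>)"

definition interference_gain :: "'w \<Rightarrow> real" where
  "interference_gain \<omega> = norm_sq K (\<lambda>k. hI k \<omega>)"

section \<open>Measurability and independence of the sources\<close>

lemma measurable_source_var:
  "j \<in> sources M K \<Longrightarrow> random_variable borel (source_var pos h hI j)"
  using independent by (auto simp: indep_vars_def)

lemma measurable_pos: "i \<in> {1..M} \<Longrightarrow> random_variable borel (pos i)"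
  using measurable_source_var[of "Location i"] by (simp add: sources_def)

lemma measurable_h: "i \<in> {1..M} \<Longrightarrow> k \<in> {1..K} \<Longrightarrow> random_variable borel (h i k)"
  using measurable_source_var[of "Fading i k"] by (auto simp: sources_def image_iff)

lemma measurable_hI: "k \<in> {1..K} \<Longrightarrow> random_variable borel (hI k)"
  using measurable_source_var[of "Interference k"] by (auto simp: sources_def)

lemma finite_sources: "finite (sources M K)"
  by (simp add: sources_def)

text \<open>Independence passes to subfamilies. \<open>J\<close> is nonempty so that the event is an
  intersection of preimages within the sample space.\<close>

lemma prob_sources:
  assumes J: "J \<subseteq> sources M K" "J \<noteq> {}" and A: "\<And>j. j \<in> J \<Longrightarrow> A j \<in> sets borel"
  shows "prob {\<omega> \<in> space W. \<forall>j\<in>J. source_var pos h hI j \<omega> \<in> A j}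
    = (\<Prod>j\<in>J. prob {\<omega> \<in> space W. source_var pos h hI j \<omega> \<in> A j})"
proof -
  have "{\<omega> \<in> space W. \<forall>j\<in>J. source_var pos h hI j \<omega> \<in> A j}
      = (\<Inter>j\<in>J. source_var pos h hI j -` A j \<inter> space W)"
    using J(2) by auto
  moreover have "{\<omega> \<in> space W. source_var pos h hI j \<omega> \<in> A j}
      = source_var pos h hI j -` A j \<inter> space W" for j
    by auto
  ultimately show ?thesis
    using indep_varsD[OF independent J(2) finite_subset[OF J(1) finite_sources] J(1), of A] A
    by simp
qed

text \<open>The event constrains \<open>card S * K\<close> independent coefficients of one common
  law. This count is the origin of the diversity order.\<close>

lemma prob_fading_ball:
  assumes S: "S \<subseteq> {1..M}" "S \<noteq> {}"
  shows "prob {\<omega> \<in> space W. \<forall>i\<in>S. \<forall>k\<in>{1..K}. cmod (h i k \<omega>) < r}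
    = measure (complex_normal 1) (ball 0 r) ^ (card S * K)"
proof -
  let ?J = "(\<lambda>(i, k). Fading i k) ` (S \<times> {1..K})"
  \<comment> \<open>Distinct index pairs are distinct sources, so the product over sources can be
    reindexed by pairs.\<close>
  have inj: "inj_on (\<lambda>(i, k). Fading i k) (S \<times> {1..K})" by (auto simp: inj_on_def)
  have J: "?J \<subseteq> sources M K" using S(1) by (fastforce simp: sources_def)
  have "?J \<noteq> {}" using S(2) K_pos by simp
  have "{\<omega> \<in> space W. \<forall>i\<in>S. \<forall>k\<in>{1..K}. cmod (h i k \<omega>) < r}
      = {\<omega> \<in> space W. \<forall>j\<in>?J. source_var pos h hI j \<omega> \<in> ball 0 r}"
    by auto
  also have "prob \<dots> = (\<Prod>j\<in>?J. prob {\<omega> \<in> space W. source_var pos h hI j \<omega> \<in> ball 0 r})"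
    by (rule prob_sources[OF J \<open>?J \<noteq> {}\<close>]) auto
  also have "\<dots> = (\<Prod>(i, k)\<in>S \<times> {1..K}. prob {\<omega> \<in> space W. h i k \<omega> \<in> ball 0 r})"
    by (subst prod.reindex[OF inj]) (auto intro!: prod.cong)
  also have "\<dots> = (\<Prod>(i, k)\<in>S \<times> {1..K}. measure (complex_normal 1) (ball 0 r))"
  proof (intro prod.cong refl, clarify)
    fix i k assume "i \<in> S" "k \<in> {1..K}"
    then have ik: "i \<in> {1..M}" "k \<in> {1..K}" using S(1) by auto
    have "measure (complex_normal 1) (ball 0 r) = measure (distr W borel (h i k)) (ball 0 r)"
      by (simp only: fading[OF ik])
    also have "\<dots> = prob {\<omega> \<in> space W. h i k \<omega> \<in> ball 0 r}"
      by (subst measure_distr[OF measurable_h[OF ik]]) (auto intro: arg_cong[where f = prob])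
    finally show "prob {\<omega> \<in> space W. h i k \<omega> \<in> ball 0 r} = measure (complex_normal 1) (ball 0 r)"
      by simp
  qed
  also have "\<dots> = measure (complex_normal 1) (ball 0 r) ^ (card S * K)"
    by (simp add: case_prod_unfold card_cartesian_product)
  finally show ?thesis .
qed

section \<open>Single gains, ordered gains and their measurability\<close>

text \<open>The location enters only through the path-loss denominator, which makes the gain
  comparable with the squared norm of the fading vector.\<close>

lemma gain_eq:
  "gain i \<omega> = \<eta> * (\<Sum>k = 1..K. (cmod (h i k \<omega>))\<^sup>2) / (1 + cmod (pos i \<omega>) powr \<alpha>)"
proof -
  have "1 + cmod (pos i \<omega>) powr \<alpha> > 0" by (smt (verit) powr_ge_zero)
  then show ?thesis
    using \<eta>_pos
    by (simp add: gain_def norm_sq_def channel_def norm_divide norm_mult power_divide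
        power_mult_distrib sum_distrib_left sum_divide_distrib)
qed

lemma measurable_gain:
  assumes "i \<in> {1..M}"
  shows "random_variable borel (gain i)"
proof -
  note [measurable] = measurable_pos[OF assms] measurable_h[OF assms]
  show ?thesis
    unfolding gain_eq[abs_def] by measurable
qed

lemma ordered_gain_eq:
  "ordered_gain \<phi> \<omega> = gain (user_at M K (channel \<eta> \<alpha> pos h) \<phi> \<omega>) \<omega>"
  by (simp add: ordered_gain_def gain_def ordered_channel_def)

lemma ordered_gain_nonneg: "ordered_gain \<phi> \<omega> \<ge> 0"
  by (simp add: ordered_gain_def norm_sq_def sum_nonneg)

lemma ordered_gain_mono:
  "1 \<le> \<phi> \<Longrightarrow> \<phi> \<le> \<psi> \<Longrightarrow> \<psi> \<le> M \<Longrightarrow> ordered_gain \<phi> \<omega> \<le> ordered_gain \<psi> \<omega>"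
  unfolding ordered_gain_def by (rule norm_sq_ordered_channel_mono)

lemma ordered_gain_less_iff:
  assumes "1 \<le> \<phi>" and "\<phi> \<le> M"
  shows "ordered_gain \<phi> \<omega> < x \<longleftrightarrow> (\<exists>S \<subseteq> {1..M}. card S = \<phi> \<and> (\<forall>i\<in>S. gain i \<omega> < x))"
  unfolding ordered_gain_def gain_def by (rule norm_sq_ordered_channel_less_iff[OF assms])

text \<open>This finite union serves twice: for measurability of the order statistics and for the
  union bound on their lower tail.\<close>

lemma ordered_gain_less_event:
  assumes "1 \<le> \<phi>" and "\<phi> \<le> M"
  shows "{\<omega> \<in> space W. ordered_gain \<phi> \<omega> < x}
    = (\<Union>S \<in> {S. S \<subseteq> {1..M} \<and> card S = \<phi>}. {\<omega> \<in> space W. \<forall>i\<in>S. gain i \<omega> < x})"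
  using ordered_gain_less_iff[OF assms] by auto

lemma gain_less_event:
  assumes "S \<subseteq> {1..M}"
  shows "{\<omega> \<in> space W. \<forall>i\<in>S. gain i \<omega> < x} \<in> events"
proof -
  have "finite S" using assms finite_subset by blast
  moreover have "{\<omega> \<in> space W. gain i \<omega> < x} \<in> events" if "i \<in> S" for i
  proof -
    have [measurable]: "random_variable borel (gain i)"
      using measurable_gain that assms by auto
    show ?thesis by measurable
  qed
  ultimately show ?thesis by (intro sets.sets_Collect_finite_All)
qed

lemma measurable_ordered_gain:
  assumes "1 \<le> \<phi>" and "\<phi> \<le> M"
  shows "random_variable borel (ordered_gain \<phi>)"
  unfolding borel_measurable_iff_less ordered_gain_less_event[OF assms]
proof (intro allI sets.finite_UN)
  show "finite {S. S \<subseteq> {1..M} \<and> card S = \<phi>}"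
    by (rule finite_subset[of _ "Pow {1..M}"]) auto
qed (use gain_less_event in blast)

lemma measurable_interference_gain: "random_variable borel interference_gain"
proof -
  note [measurable] = measurable_hI
  show ?thesis unfolding interference_gain_def[abs_def] norm_sq_def by measurable
qed

section \<open>Comparison of gains with fading coefficients\<close>

lemma prob_pos_in_disc: "i \<in> {1..M} \<Longrightarrow> prob {\<omega> \<in> space W. cmod (pos i \<omega>) \<le> R} = 1"
proof -
  assume i: "i \<in> {1..M}"
  have "1 = measure (distr W borel (pos i)) (cball 0 R)"
    using emeasure_uniform_disc_cball[OF R_pos] by (simp add: locations[OF i] measure_def)
  also have "\<dots> = prob {\<omega> \<in> space W. cmod (pos i \<omega>) \<le> R}"
    by (subst measure_distr[OF measurable_pos[OF i]])
      (auto intro: arg_cong[where f = prob])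
  finally show ?thesis by simp
qed

text \<open>A location is known only in law, so it lies in the disc only up to a null set; finitely
  many null sets are merged.\<close>

lemma AE_pos_in_disc: "AE \<omega> in W. \<forall>i\<in>{1..M}. cmod (pos i \<omega>) \<le> R"
proof (rule AE_finite_allI)
  fix i assume i: "i \<in> {1..M}"
  note [measurable] = measurable_pos[OF i]
  show "AE \<omega> in W. cmod (pos i \<omega>) \<le> R"
    using prob_pos_in_disc[OF i] by (subst (asm) prob_Collect_eq_1) measurable
qed simp

text \<open>The path-loss denominator is at least 1, wherever the user is.\<close>

lemma gain_le: "gain i \<omega> \<le> \<eta> * (\<Sum>k = 1..K. (cmod (h i k \<omega>))\<^sup>2)"
proof -
  have "\<eta> * (\<Sum>k = 1..K. (cmod (h i k \<omega>))\<^sup>2) / (1 + cmod (pos i \<omega>) powr \<alpha>)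
      \<le> \<eta> * (\<Sum>k = 1..K. (cmod (h i k \<omega>))\<^sup>2) / 1"
    using \<eta>_pos by (intro divide_left_mono mult_nonneg_nonneg sum_nonneg) (auto simp: add_pos_nonneg)
  then show ?thesis by (simp add: gain_eq)
qed

text \<open>Since \<alpha> is positive, path loss grows with distance and is worst on the rim of the
  disc.\<close>

lemma gain_ge:
  assumes "cmod (pos i \<omega>) \<le> R"
  shows "\<eta> * (\<Sum>k = 1..K. (cmod (h i k \<omega>))\<^sup>2) / (1 + R powr \<alpha>) \<le> gain i \<omega>"
  unfolding gain_eq using \<eta>_pos \<alpha>_pos assms
  by (intro divide_left_mono mult_nonneg_nonneg sum_nonneg)
    (auto simp: add_pos_nonneg powr_mono2)

section \<open>Lower tail of the ordered gains\<close>

text \<open>It suffices that one fixed set of \<phi> users, here those with original indices 1 to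
  \<phi>, has small fading coefficients throughout.\<close>

lemma prob_ordered_gain_less_ge:
  assumes \<phi>: "1 \<le> \<phi>" "\<phi> \<le> M" and x: "0 < x" "x \<le> \<eta> * K"
  shows "(exp (-1) * (x / (\<eta> * K))) ^ (\<phi> * K) \<le> prob {\<omega> \<in> space W. ordered_gain \<phi> \<omega> < x}"
proof -
  \<comment> \<open>With this radius, \<open>K\<close> coefficients of modulus below
    \<open>r\<close> keep \<eta> times the sum of squares below \<open>x\<close>. The assumption
    \<open>x \<le> \<eta> * K\<close> gives \<open>r \<le> 1\<close>, hence the uniform factor
    \<open>exp (-1)\<close>.\<close>
  define r where "r = sqrt (x / (\<eta> * K))"
  have eK: "\<eta> * K > 0" using \<eta>_pos K_pos by simp
  have r: "0 \<le> r" "r\<^sup>2 = x / (\<eta> * K)" "r\<^sup>2 \<le> 1"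
    using x eK by (auto simp: r_def)
  have "exp (-1) * r\<^sup>2 \<le> exp (- r\<^sup>2) * r\<^sup>2" using r(3) by (intro mult_right_mono) auto
  also have "\<dots> \<le> measure (complex_normal 1) (ball 0 r)"
    by (rule measure_complex_normal_ball(2)[OF r(1)])
  finally have "(exp (-1) * (x / (\<eta> * K))) ^ (\<phi> * K)
      \<le> measure (complex_normal 1) (ball 0 r) ^ (\<phi> * K)"
    unfolding r(2) using x eK by (intro power_mono) auto
  also have "\<dots> = prob {\<omega> \<in> space W. \<forall>i\<in>{1..\<phi>}. \<forall>k\<in>{1..K}. cmod (h i k \<omega>) < r}"
    using \<phi> by (subst prob_fading_ball) auto
  also have "\<dots> \<le> prob {\<omega> \<in> space W. ordered_gain \<phi> \<omega> < x}"
  proof (rule finite_measure_mono)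
    note [measurable] = measurable_ordered_gain[OF \<phi>]
    show "{\<omega> \<in> space W. ordered_gain \<phi> \<omega> < x} \<in> events" by measurable
    show "{\<omega> \<in> space W. \<forall>i\<in>{1..\<phi>}. \<forall>k\<in>{1..K}. cmod (h i k \<omega>) < r}
        \<subseteq> {\<omega> \<in> space W. ordered_gain \<phi> \<omega> < x}"
    proof clarify
      fix \<omega> assume small: "\<forall>i\<in>{1..\<phi>}. \<forall>k\<in>{1..K}. cmod (h i k \<omega>) < r"
      have "gain i \<omega> < x" if "i \<in> {1..\<phi>}" for i
      proof -
        have "(\<Sum>k = 1..K. (cmod (h i k \<omega>))\<^sup>2) < (\<Sum>k = 1..K. r\<^sup>2)"
          using small that K_pos by (intro sum_strict_mono power_strict_mono) auto
        also have "\<dots> = x / \<eta>" using \<eta>_pos K_pos by (simp add: r(2))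
        finally show ?thesis
          using gain_le[of i \<omega>] \<eta>_pos by (simp add: field_simps)
      qed
      then show "ordered_gain \<phi> \<omega> < x"
        unfolding ordered_gain_less_iff[OF \<phi>] using \<phi> by (intro exI[of _ "{1..\<phi>}"]) auto
    qed
  qed
  finally show ?thesis .
qed

text \<open>A union bound over the sets of \<phi> users, of which there are at most
  \<open>2 ^ M\<close>. Within one set, small gains force every fading coefficient to be
  small.\<close>

lemma prob_ordered_gain_less_le:
  assumes \<phi>: "1 \<le> \<phi>" "\<phi> \<le> M" and x: "0 < x"
  shows "prob {\<omega> \<in> space W. ordered_gain \<phi> \<omega> < x}
    \<le> 2 ^ M * (x * (1 + R powr \<alpha>) / \<eta>) ^ (\<phi> * K)"
proof -
  let ?F = "{S. S \<subseteq> {1..M} \<and> card S = \<phi>}"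
  \<comment> \<open>In the disc a gain below \<open>x\<close> bounds the sum of squares by
    \<open>r\<^sup>2\<close>, hence also each coefficient by \<open>r\<close>.\<close>
  define r where "r = sqrt (x * (1 + R powr \<alpha>) / \<eta>)"
  have D: "1 + R powr \<alpha> > 0" by (smt (verit) powr_ge_zero)
  have r: "0 \<le> r" "r\<^sup>2 = x * (1 + R powr \<alpha>) / \<eta>"
    using x \<eta>_pos D by (auto simp: r_def)
  have F: "?F \<subseteq> Pow {1..M}" by auto
  have finF: "finite ?F" using F finite_subset by blast
  have bound: "prob {\<omega> \<in> space W. \<forall>i\<in>S. gain i \<omega> < x} \<le> (r\<^sup>2) ^ (\<phi> * K)" if "S \<in> ?F" for S
  proof -
    have S: "S \<subseteq> {1..M}" "S \<noteq> {}" "card S = \<phi>" using that \<phi> by auto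
    have "prob {\<omega> \<in> space W. \<forall>i\<in>S. gain i \<omega> < x}
        \<le> prob {\<omega> \<in> space W. \<forall>i\<in>S. \<forall>k\<in>{1..K}. cmod (h i k \<omega>) < r}"
    \<comment> \<open>The inclusion holds only almost everywhere, because the lower bound on a gain
      needs the location to be in the disc.\<close>
    proof (rule finite_measure_mono_AE)
      show "AE \<omega> in W. \<omega> \<in> {\<omega> \<in> space W. \<forall>i\<in>S. gain i \<omega> < x}
          \<longrightarrow> \<omega> \<in> {\<omega> \<in> space W. \<forall>i\<in>S. \<forall>k\<in>{1..K}. cmod (h i k \<omega>) < r}"
        using AE_pos_in_disc
      proof eventually_elim
        case (elim \<omega>)
        have "cmod (h i k \<omega>) < r" if i: "i \<in> S" and k: "k \<in> {1..K}" and g: "gain i \<omega> < x" for i k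
        proof -
          have "cmod (pos i \<omega>) \<le> R" using elim i S(1) by auto
          then have "\<eta> * (\<Sum>k = 1..K. (cmod (h i k \<omega>))\<^sup>2) / (1 + R powr \<alpha>) < x"
            using gain_ge[of i \<omega>] g by linarith
          then have "(\<Sum>k = 1..K. (cmod (h i k \<omega>))\<^sup>2) < r\<^sup>2"
            using \<eta>_pos D by (simp add: r(2) field_simps)
          moreover have "(cmod (h i k \<omega>))\<^sup>2 \<le> (\<Sum>k = 1..K. (cmod (h i k \<omega>))\<^sup>2)"
            using k by (intro member_le_sum) auto
          ultimately show ?thesis
            using r(1) by (meson order_le_less_trans power2_less_imp_less)
        qed
        then show ?case by auto
      qed
      have "finite S" using S(1) finite_subset by blast
      have "{\<omega> \<in> space W. cmod (h i k \<omega>) < r} \<in> events" if "i \<in> S" "k \<in> {1..K}" for i k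
      proof -
        have [measurable]: "random_variable borel (h i k)" using measurable_h that S(1) by auto
        show ?thesis by measurable
      qed
      then show "{\<omega> \<in> space W. \<forall>i\<in>S. \<forall>k\<in>{1..K}. cmod (h i k \<omega>) < r} \<in> events"
        using \<open>finite S\<close> S(2) K_pos by (intro sets.sets_Collect_finite_All') auto
    qed
    also have "\<dots> = measure (complex_normal 1) (ball 0 r) ^ (\<phi> * K)"
      by (simp only: prob_fading_ball[OF S(1,2)] S(3))
    also have "\<dots> \<le> (r\<^sup>2) ^ (\<phi> * K)"
      by (intro power_mono measure_complex_normal_ball(1)[OF r(1)]) simp
    finally show ?thesis .
  qed
  have "prob {\<omega> \<in> space W. ordered_gain \<phi> \<omega> < x}
      \<le> (\<Sum>S\<in>?F. prob {\<omega> \<in> space W. \<forall>i\<in>S. gain i \<omega> < x})"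
    unfolding ordered_gain_less_event[OF \<phi>] using finF
    by (intro finite_measure_subadditive_finite) (use gain_less_event in blast)+
  also have "\<dots> \<le> (\<Sum>S\<in>?F. (r\<^sup>2) ^ (\<phi> * K))" by (rule sum_mono[OF bound])
  also have "\<dots> \<le> 2 ^ M * (r\<^sup>2) ^ (\<phi> * K)"
  proof -
    have "card ?F \<le> 2 ^ M" using card_mono[OF _ F] by (simp add: card_Pow)
    then have "real (card ?F) \<le> 2 ^ M" by (metis of_nat_le_iff of_nat_numeral of_nat_power)
    then show ?thesis by (simp add: mult_right_mono)
  qed
  finally show ?thesis by (simp add: r(2))
qed

section \<open>Interference exceeding an ordered gain\<close>

text \<open>Each source is confined to a set of positive probability, and independence makes the
  joint event positive. There all gains lie between fixed positive constants, so it is irrelevant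
  which user carries label \<phi>.\<close>

lemma prob_interference_dominates:
  assumes \<phi>: "1 \<le> \<phi>" "\<phi> \<le> M" and b: "b > 0"
  shows "\<exists>\<delta>>0. prob {\<omega> \<in> space W. \<delta> \<le> ordered_gain \<phi> \<omega> \<and> ordered_gain \<phi> \<omega> \<le> b * interference_gain \<omega>} > 0"
proof -
  define D where "D = 1 + R powr \<alpha>"
  \<comment> \<open>Fading moduli below 2 bound every gain by \<open>4 * \<eta> * K\<close>;
    \<open>L\<close> is chosen so that \<open>b * L\<^sup>2\<close> equals this bound.\<close>
  define L where "L = sqrt (4 * \<eta> * K / b)"
  \<comment> \<open>Fading lives in an annulus, interference outside a disc; both sets are open and
    nonempty, hence of positive probability. Locations fill the whole disc.\<close>
  define A where "A = (\<lambda>j. case j of Location i \<Rightarrow> cball 0 R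
    | Fading i k \<Rightarrow> ball 0 2 - cball 0 1 | Interference k \<Rightarrow> - cball (0::complex) L)"
  have "D > 0" by (smt (verit) powr_ge_zero D_def)
  have L: "L \<ge> 0" "b * L\<^sup>2 = 4 * \<eta> * K" using \<eta>_pos b by (auto simp: L_def)
  have ann: "ball (0::complex) 2 - cball 0 1 \<noteq> {}"
  proof -
    have "complex_of_real (3/2) \<in> ball 0 2 - cball 0 1" by (simp del: of_real_divide)
    then show ?thesis by blast
  qed
  have out: "- cball (0::complex) L \<noteq> {}"
  proof -
    have "complex_of_real (L + 1) \<in> - cball 0 L" using L(1) by (simp del: of_real_add)
    then show ?thesis by blast
  qed
  have pos_distr: "prob {\<omega> \<in> space W. X \<omega> \<in> U} > 0"
    if "random_variable borel X" "distr W borel X = complex_normal u" "u > 0" "open U" "U \<noteq> {}"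
    for X :: "'w \<Rightarrow> complex" and U u
  proof -
    have "emeasure (distr W borel X) U > 0"
      using emeasure_complex_normal_open_pos that by simp
    moreover have "X -` U \<inter> space W = {\<omega> \<in> space W. X \<omega> \<in> U}" by auto
    ultimately show ?thesis
      using that(1,4) by (simp add: emeasure_distr emeasure_eq_measure)
  qed
  have prob_A: "prob {\<omega> \<in> space W. source_var pos h hI j \<omega> \<in> A j} > 0" if j: "j \<in> sources M K" for j
  proof (cases j)
    case (Location i)
    then show ?thesis
      using j prob_pos_in_disc[of i] by (auto simp: A_def sources_def)
  next
    case (Fading i k)
    then have ik: "i \<in> {1..M}" "k \<in> {1..K}" using j by (auto simp: sources_def)
    show ?thesis
      using pos_distr[OF measurable_h[OF ik] fading[OF ik] _ _ ann] Fading
      by (simp add: A_def open_Diff)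
  next
    case (Interference k)
    then have k: "k \<in> {1..K}" using j by (auto simp: sources_def)
    show ?thesis
      using pos_distr[OF measurable_hI[OF k] interference[OF k] v_pos _ out] Interference
      by (simp add: A_def open_Compl)
  qed
  have "Interference 1 \<in> sources M K" using K_pos by (auto simp: sources_def)
  then have "prob {\<omega> \<in> space W. \<forall>j\<in>sources M K. source_var pos h hI j \<omega> \<in> A j}
      = (\<Prod>j\<in>sources M K. prob {\<omega> \<in> space W. source_var pos h hI j \<omega> \<in> A j})"
    by (intro prob_sources) (auto simp: A_def split: source.split)
  also have "\<dots> > 0" by (intro prod_pos prob_A)
  finally have "0 < prob {\<omega> \<in> space W. \<forall>j\<in>sources M K. source_var pos h hI j \<omega> \<in> A j}" .
  also have "\<dots> \<le> prob {\<omega> \<in> space W. \<eta> * K / D \<le> ordered_gain \<phi> \<omega>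
      \<and> ordered_gain \<phi> \<omega> \<le> b * interference_gain \<omega>}"
  proof (rule finite_measure_mono)
    note [measurable] = measurable_ordered_gain[OF \<phi>] measurable_interference_gain
    show "{\<omega> \<in> space W. \<eta> * K / D \<le> ordered_gain \<phi> \<omega>
      \<and> ordered_gain \<phi> \<omega> \<le> b * interference_gain \<omega>} \<in> events" by measurable
    show "{\<omega> \<in> space W. \<forall>j\<in>sources M K. source_var pos h hI j \<omega> \<in> A j}
      \<subseteq> {\<omega> \<in> space W. \<eta> * K / D \<le> ordered_gain \<phi> \<omega>
        \<and> ordered_gain \<phi> \<omega> \<le> b * interference_gain \<omega>}"
    proof clarify
      fix \<omega> assume E: "\<forall>j\<in>sources M K. source_var pos h hI j \<omega> \<in> A j"
      \<comment> \<open>This user depends on \<omega>, which is why all users were confined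
        beforehand.\<close>
      define i where "i = user_at M K (channel \<eta> \<alpha> pos h) \<phi> \<omega>"
      have i: "i \<in> {1..M}"
        unfolding i_def using bij_betw_user_at[of M K "channel \<eta> \<alpha> pos h" \<omega>] \<phi>
        by (meson atLeastAtMost_iff bij_betwE)
      have "Location i \<in> sources M K" using i by (auto simp: sources_def)
      with E have "source_var pos h hI (Location i) \<omega> \<in> A (Location i)" by blast
      then have disc: "cmod (pos i \<omega>) \<le> R" by (simp add: A_def)
      have ring: "1 < cmod (h i k \<omega>) \<and> cmod (h i k \<omega>) < 2" if "k \<in> {1..K}" for k
      proof -
        have "Fading i k \<in> sources M K" using i that by (auto simp: sources_def)
        with E have "source_var pos h hI (Fading i k) \<omega> \<in> A (Fading i k)" by blast
        then show ?thesis by (simp add: A_def)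
      qed
      have far: "L < cmod (hI k \<omega>)" if "k \<in> {1..K}" for k
      proof -
        have "Interference k \<in> sources M K" using that by (auto simp: sources_def)
        with E have "source_var pos h hI (Interference k) \<omega> \<in> A (Interference k)" by blast
        then show ?thesis by (simp add: A_def)
      qed
      have "(\<Sum>k = 1..K. 1) \<le> (\<Sum>k = 1..K. (cmod (h i k \<omega>))\<^sup>2)"
        using ring by (intro sum_mono) (simp add: one_le_power less_imp_le)
      then have "\<eta> * K / D \<le> \<eta> * (\<Sum>k = 1..K. (cmod (h i k \<omega>))\<^sup>2) / D"
        using \<open>D > 0\<close> \<eta>_pos by (intro divide_right_mono mult_left_mono) auto
      also have "\<dots> \<le> ordered_gain \<phi> \<omega>"
        using gain_ge[OF disc] by (simp add: D_def ordered_gain_eq i_def)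
      finally have lower: "\<eta> * K / D \<le> ordered_gain \<phi> \<omega>" .
      have "(\<Sum>k = 1..K. (cmod (h i k \<omega>))\<^sup>2) \<le> (\<Sum>k = 1..K. 2\<^sup>2)"
        using ring by (intro sum_mono power_mono) (auto simp: less_imp_le)
      then have "\<eta> * (\<Sum>k = 1..K. (cmod (h i k \<omega>))\<^sup>2) \<le> 4 * \<eta> * K"
        using \<eta>_pos by simp
      then have "ordered_gain \<phi> \<omega> \<le> 4 * \<eta> * K"
        using gain_le[of i \<omega>] by (simp add: ordered_gain_eq i_def)
      also have "\<dots> = b * L\<^sup>2" by (simp add: L(2))
      also have "\<dots> \<le> b * (\<Sum>k = 1..K. (cmod (hI k \<omega>))\<^sup>2)"
      proof (intro mult_left_mono)
        \<comment> \<open>A single interference coefficient is already large enough.\<close>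
        have "L\<^sup>2 \<le> (cmod (hI 1 \<omega>))\<^sup>2" using far[of 1] K_pos L(1) by (intro power_mono) auto
        also have "\<dots> \<le> (\<Sum>k = 1..K. (cmod (hI k \<omega>))\<^sup>2)"
          using K_pos by (intro member_le_sum) auto
        finally show "L\<^sup>2 \<le> (\<Sum>k = 1..K. (cmod (hI k \<omega>))\<^sup>2)" .
      qed (use b in simp)
      finally show "\<eta> * K / D \<le> ordered_gain \<phi> \<omega> \<and> ordered_gain \<phi> \<omega> \<le> b * interference_gain \<omega>"
        using lower by (simp add: interference_gain_def norm_sq_def)
    qed
  qed
  finally show ?thesis
    using \<open>D > 0\<close> \<eta>_pos K_pos by (intro exI[of _ "\<eta> * K / D"]) auto
qed

end

text \<open>This keeps the outage expressions of user n, which are sums of two probabilities, at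
  most 1.\<close>

lemma (in prob_space) prob_add_disjoint_le_1:
  assumes "A \<in> events" "B \<in> events" "A \<inter> B = {}"
  shows "prob A + prob B \<le> 1"
  using finite_measure_Union[OF assms] by (metis prob_le_1)

section \<open>Diversity order\<close>

text \<open>After taking logarithms and dividing by \<open>ln \<rho>\<close>, the constants
  contribute \<open>ln c / ln \<rho>\<close> and \<open>ln C / ln \<rho>\<close>, which vanish in
  the limit.\<close>

lemma has_diversity_orderI:
  assumes "c > 0"
    and lower: "eventually (\<lambda>\<rho>. c * \<rho> powr (- d) \<le> P \<rho>) at_top"
    and upper: "eventually (\<lambda>\<rho>. P \<rho> \<le> C * \<rho> powr (- d)) at_top"
  shows "has_diversity_order P d"
proof -
  have pos: "eventually (\<lambda>\<rho>. P \<rho> > 0) at_top"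
    using lower eventually_gt_at_top[of 0]
  proof eventually_elim
    case (elim \<rho>)
    then show ?case using \<open>c > 0\<close> by (smt (verit) mult_pos_pos powr_gt_zero)
  qed
  \<comment> \<open>\<open>P\<close> is its own asymptotic form; eventual positivity excludes the
    quotient 0 / 0, whose value is 0.\<close>
  have ratio: "((\<lambda>\<rho>. P \<rho> / P \<rho>) \<longlongrightarrow> 1) at_top"
    by (rule tendsto_eventually, use pos in eventually_elim) simp
  have vanish: "((\<lambda>\<rho>. d - ln k / ln \<rho>) \<longlongrightarrow> d) at_top" for k :: real
    using tendsto_diff[OF tendsto_const tendsto_divide_0[OF tendsto_const
          filterlim_at_top_imp_at_infinity[OF ln_at_top]], of d "ln k"]
    by simp
  have "((\<lambda>\<rho>. - (ln (P \<rho>) / ln \<rho>)) \<longlongrightarrow> d) at_top"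
  \<comment> \<open>The minus sign swaps the roles: the upper constant \<open>C\<close> gives the
    lower bound on the exponent.\<close>
  proof (rule tendsto_sandwich[OF _ _ vanish[of C] vanish[of c]])
    show "eventually (\<lambda>\<rho>. d - ln C / ln \<rho> \<le> - (ln (P \<rho>) / ln \<rho>)) at_top"
      using upper pos eventually_gt_at_top[of 1]
    proof eventually_elim
      case (elim \<rho>)
      then have "0 < C * \<rho> powr (- d)" by linarith
      \<comment> \<open>Positivity of \<open>C\<close> is not assumed; it follows because the
        positive \<open>P \<rho>\<close> lies below the bound.\<close>
      then have "C > 0" using elim(3) by (simp add: zero_less_mult_iff)
      have "ln (P \<rho>) \<le> ln (C * \<rho> powr (- d))" using elim by (subst ln_le_cancel_iff) linarith+
      also have "\<dots> = ln C - d * ln \<rho>"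
        using \<open>C > 0\<close> elim by (simp add: ln_mult ln_powr)
      finally have "ln (P \<rho>) / ln \<rho> \<le> (ln C - d * ln \<rho>) / ln \<rho>"
        using elim by (intro divide_right_mono) auto
      then show ?case using elim by (simp add: diff_divide_distrib)
    qed
    show "eventually (\<lambda>\<rho>. - (ln (P \<rho>) / ln \<rho>) \<le> d - ln c / ln \<rho>) at_top"
      using lower pos eventually_gt_at_top[of 1]
    proof eventually_elim
      case (elim \<rho>)
      have "ln c - d * ln \<rho> = ln (c * \<rho> powr (- d))"
        using \<open>c > 0\<close> elim by (simp add: ln_mult ln_powr)
      also have "\<dots> \<le> ln (P \<rho>)" using elim \<open>c > 0\<close> by (subst ln_le_cancel_iff) auto
      finally have "(ln c - d * ln \<rho>) / ln \<rho> \<le> ln (P \<rho>) / ln \<rho>"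
        using elim by (intro divide_right_mono) auto
      then show ?case using elim by (simp add: diff_divide_distrib)
    qed
  qed
  with ratio show ?thesis unfolding has_diversity_order_def by blast
qed

section \<open>SINR thresholds and bounds for the pair outage\<close>

text \<open>Clearing the positive denominator leaves an inequality linear in \<open>z\<close>, whose
  coefficient is positive because \<open>a > \<epsilon> * b\<close>.\<close>

lemma sinr_less_iff:
  fixes z :: real
  assumes "\<rho> > 0" "z \<ge> 0" "b \<ge> 0" "a > \<epsilon> * b"
  shows "\<rho> * z * a / (\<rho> * z * b + 1) < \<epsilon> \<longleftrightarrow> z < \<epsilon> / (a - \<epsilon> * b) / \<rho>"
proof -
  have "\<rho> * z * b + 1 > 0" using assms by (simp add: add_nonneg_pos)
  then have "\<rho> * z * a / (\<rho> * z * b + 1) < \<epsilon> \<longleftrightarrow> \<rho> * z * a < \<epsilon> * (\<rho> * z * b + 1)"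
    by (simp add: pos_divide_less_eq)
  also have "\<dots> \<longleftrightarrow> z * \<rho> * (a - \<epsilon> * b) < \<epsilon>"
    by (simp add: algebra_simps)
  also have "\<dots> \<longleftrightarrow> z < \<epsilon> / (a - \<epsilon> * b) / \<rho>"
    using assms by (simp add: pos_less_divide_eq mult_ac)
  finally show ?thesis .
qed

text \<open>The same computation for a weak inequality; \<open>b = 0\<close> covers the own signal
  of user n under perfect SIC.\<close>

lemma sinr_le_iff:
  fixes z :: real
  assumes "\<rho> > 0" "z \<ge> 0" "b \<ge> 0" "a > \<epsilon> * b"
  shows "\<rho> * z * a / (\<rho> * z * b + 1) \<le> \<epsilon> \<longleftrightarrow> z \<le> \<epsilon> / (a - \<epsilon> * b) / \<rho>"
proof -
  have "\<rho> * z * b + 1 > 0" using assms by (simp add: add_nonneg_pos)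
  then have "\<rho> * z * a / (\<rho> * z * b + 1) \<le> \<epsilon> \<longleftrightarrow> \<rho> * z * a \<le> \<epsilon> * (\<rho> * z * b + 1)"
    by (simp add: pos_divide_le_eq)
  also have "\<dots> \<longleftrightarrow> z * \<rho> * (a - \<epsilon> * b) \<le> \<epsilon>"
    by (simp add: algebra_simps)
  also have "\<dots> \<longleftrightarrow> z \<le> \<epsilon> / (a - \<epsilon> * b) / \<rho>"
    using assms by (simp add: pos_le_divide_eq mult_ac)
  finally show ?thesis .
qed

text \<open>All four bounds are read off from
  \<open>P + (1 - P) * Q = Q + P * (1 - Q) = P + Q - P * Q\<close>.\<close>

lemma outage_pair_bounds:
  assumes "0 \<le> P \<rho>" "P \<rho> \<le> 1" "0 \<le> Q \<rho>" "Q \<rho> \<le> 1"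
  shows "P \<rho> \<le> outage_pair P Q \<rho>" and "Q \<rho> \<le> outage_pair P Q \<rho>"
    and "outage_pair P Q \<rho> \<le> 1" and "outage_pair P Q \<rho> \<le> P \<rho> + Q \<rho>"
proof -
  have "0 \<le> (1 - P \<rho>) * Q \<rho>" "0 \<le> P \<rho> * (1 - Q \<rho>)" "0 \<le> (1 - P \<rho>) * (1 - Q \<rho>)"
    "0 \<le> P \<rho> * Q \<rho>"
    using assms by auto
  then show "P \<rho> \<le> outage_pair P Q \<rho>" "Q \<rho> \<le> outage_pair P Q \<rho>"
    "outage_pair P Q \<rho> \<le> 1" "outage_pair P Q \<rho> \<le> P \<rho> + Q \<rho>"
    unfolding outage_pair_def by (simp_all add: algebra_simps)
qed

theorem mainTheorem9:
  fixes W :: "'w measure"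
    and M K m n :: nat
    and \<eta> \<alpha> R\<^sub>D \<Omega>\<^sub>I a\<^sub>m a\<^sub>n R\<^sub>m R\<^sub>n \<epsilon>\<^sub>m \<epsilon>\<^sub>n :: real
    and g\<^sub>m g\<^sub>n :: "nat \<Rightarrow> nat"
    and pos :: "nat \<Rightarrow> 'w \<Rightarrow> complex"
    and h :: "nat \<Rightarrow> nat \<Rightarrow> 'w \<Rightarrow> complex"
    and h\<^sub>I :: "nat \<Rightarrow> 'w \<Rightarrow> complex"
    and Z :: "nat \<Rightarrow> 'w \<Rightarrow> real" and Y\<^sub>I :: "'w \<Rightarrow> real"
    and P\<^sub>m :: "real \<Rightarrow> real" and P\<^sub>n :: "real \<Rightarrow> real \<Rightarrow> real"
  assumes "K < M" and "1 \<le> K" and "1 \<le> m" and "m < n" and "n \<le> M"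
    and "\<eta> > 0" and "\<alpha> > 0" and "R\<^sub>D > 0" and "\<Omega>\<^sub>I > 0"
    and "a\<^sub>m > a\<^sub>n" and "a\<^sub>n > 0" and "a\<^sub>m + a\<^sub>n = 1"
    and "R\<^sub>m > 0" and "R\<^sub>n > 0"
    and "\<epsilon>\<^sub>m = 2 powr R\<^sub>m - 1" and "\<epsilon>\<^sub>n = 2 powr R\<^sub>n - 1"
    and spreading_vectors: "\<And>k. k \<in> {1..K} \<Longrightarrow> g\<^sub>m k \<in> {0, 1} \<and> g\<^sub>n k \<in> {0, 1}"
    and same_weight: "(\<Sum>k = 1..K. g\<^sub>m k) = (\<Sum>k = 1..K. g\<^sub>n k)"
    and all_occupied: "\<And>k. k \<in> {1..K} \<Longrightarrow> g\<^sub>m k \<noteq> 0 \<and> g\<^sub>n k \<noteq> 0"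
    and "prob_space W"
    and independent:
      "prob_space.indep_vars W (\<lambda>_. borel) (source_var pos h h\<^sub>I) (sources M K)"
    and locations: "\<And>i. i \<in> {1..M} \<Longrightarrow> distr W borel (pos i) = uniform_disc R\<^sub>D"
    and fading: "\<And>i k. i \<in> {1..M} \<Longrightarrow> k \<in> {1..K} \<Longrightarrow> distr W borel (h i k) = complex_normal 1"
    and interference: "\<And>k. k \<in> {1..K} \<Longrightarrow> distr W borel (h\<^sub>I k) = complex_normal \<Omega>\<^sub>I"
    and ordered_gains:
      "\<And>\<phi> \<omega>. Z \<phi> \<omega> = norm_sq K (ordered_channel M K (channel \<eta> \<alpha> pos h) \<phi> \<omega>)"
    and interference_gain: "\<And>\<omega>. Y\<^sub>I \<omega> = norm_sq K (\<lambda>k. h\<^sub>I k \<omega>)"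
    and "a\<^sub>m > \<epsilon>\<^sub>m * a\<^sub>n" and "a\<^sub>n > \<epsilon>\<^sub>n * a\<^sub>m"
    and outage_user_m: "P\<^sub>m = outage_m W a\<^sub>m a\<^sub>n \<epsilon>\<^sub>m (Z m)"
    and outage_user_n: "P\<^sub>n \<in> {outage_n1 W a\<^sub>m a\<^sub>n \<epsilon>\<^sub>m \<epsilon>\<^sub>n (Z n) Y\<^sub>I, outage_n2 W a\<^sub>m a\<^sub>n \<epsilon>\<^sub>m \<epsilon>\<^sub>n (Z n) Y\<^sub>I}"
  shows "(K \<noteq> 1 \<longrightarrow> has_diversity_order (outage_pair P\<^sub>m (P\<^sub>n 1)) 0)
       \<and> (K = 1 \<longrightarrow> has_diversity_order (outage_pair P\<^sub>m (P\<^sub>n 1)) 0)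
       \<and> (K \<noteq> 1 \<longrightarrow> has_diversity_order (outage_pair P\<^sub>m (P\<^sub>n 0)) (real (m * K)))
       \<and> (K = 1 \<longrightarrow> has_diversity_order (outage_pair P\<^sub>m (P\<^sub>n 0)) (real m))"
proof -
  interpret noma_channel W M K \<eta> \<alpha> R\<^sub>D \<Omega>\<^sub>I pos h h\<^sub>I
    by (intro noma_channel.intro noma_channel_axioms.intro; fact)

  \<comment> \<open>Gain thresholds of the outage events\<close>
  have Zeq: "Z \<phi> = ordered_gain \<phi>" for \<phi>
    by (rule ext) (simp add: ordered_gains ordered_gain_def)
  have Yeq: "Y\<^sub>I = interference_gain"
    by (rule ext) (simp add: interference_gain interference_gain_def)
  have mM: "1 \<le> m" "m \<le> M" and nM: "1 \<le> n" "n \<le> M" and "m \<le> n"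
    using assms(3-5) by auto
  have Z0: "Z \<phi> \<omega> \<ge> 0" and Zmn: "Z m \<omega> \<le> Z n \<omega>" for \<phi> \<omega>
    unfolding Zeq using ordered_gain_nonneg ordered_gain_mono mM nM \<open>m \<le> n\<close> by auto
  have Y0: "Y\<^sub>I \<omega> \<ge> 0" for \<omega>
    by (simp add: interference_gain norm_sq_def sum_nonneg)
  have [measurable]: "Z m \<in> borel_measurable W" "Z n \<in> borel_measurable W" "Y\<^sub>I \<in> borel_measurable W"
    unfolding Zeq Yeq using measurable_ordered_gain mM nM measurable_interference_gain by auto
  have \<epsilon>: "\<epsilon>\<^sub>m > 0" "\<epsilon>\<^sub>n > 0"
    using powr_less_mono[of 0 R\<^sub>m 2] powr_less_mono[of 0 R\<^sub>n 2] assms(13-16) by auto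
  \<comment> \<open>Decoding the signal of user m fails for gains up to about
    \<open>t / \<rho>\<close>, at either user. Under perfect SIC the own signal of user n fails up
    to \<open>u / \<rho>\<close>; under imperfect SIC a gain of at most \<open>u\<close> times the
    interference suffices for failure.\<close>
  define t where "t = \<epsilon>\<^sub>m / (a\<^sub>m - \<epsilon>\<^sub>m * a\<^sub>n)"
  define u where "u = \<epsilon>\<^sub>n / a\<^sub>n"
  have tu: "t > 0" "u > 0"
    using \<epsilon> \<open>a\<^sub>m > \<epsilon>\<^sub>m * a\<^sub>n\<close> \<open>a\<^sub>n > 0\<close> by (auto simp: t_def u_def)
  have sinr_m_iff: "sinr_m a\<^sub>m a\<^sub>n \<rho> z < \<epsilon>\<^sub>m \<longleftrightarrow> z < t / \<rho>"
    and sinr_nm_iff: "sinr_nm a\<^sub>m a\<^sub>n \<rho> z \<le> \<epsilon>\<^sub>m \<longleftrightarrow> z \<le> t / \<rho>"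
    and sinr_n_iff: "sinr_n 0 a\<^sub>n \<rho> z y \<le> \<epsilon>\<^sub>n \<longleftrightarrow> z \<le> u / \<rho>"
    if "\<rho> > 0" "z \<ge> 0" for \<rho> z y
    using that sinr_less_iff[of \<rho> z a\<^sub>n \<epsilon>\<^sub>m a\<^sub>m] sinr_le_iff[of \<rho> z a\<^sub>n \<epsilon>\<^sub>m a\<^sub>m]
      sinr_le_iff[of \<rho> z 0 \<epsilon>\<^sub>n a\<^sub>n] \<open>a\<^sub>m > \<epsilon>\<^sub>m * a\<^sub>n\<close> \<open>a\<^sub>n > 0\<close>
    by (simp_all add: sinr_m_def sinr_nm_def sinr_n_def t_def u_def)
  have Pm_eq: "P\<^sub>m \<rho> = prob {\<omega> \<in> space W. Z m \<omega> < t / \<rho>}" if "\<rho> > 0" for \<rho>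
    unfolding outage_user_m outage_m_def using sinr_m_iff[OF that Z0] by simp
  have Pm01: "0 \<le> P\<^sub>m \<rho>" "P\<^sub>m \<rho> \<le> 1" for \<rho>
    by (simp_all add: outage_user_m outage_m_def)

  let ?A1 = "\<lambda>\<rho>. {\<omega> \<in> space W. sinr_nm a\<^sub>m a\<^sub>n \<rho> (Z n \<omega>) \<le> \<epsilon>\<^sub>m}"
  let ?A2 = "\<lambda>\<rho>. {\<omega> \<in> space W. sinr_nm a\<^sub>m a\<^sub>n \<rho> (Z n \<omega>) \<le> \<epsilon>\<^sub>m \<and> sinr_nn a\<^sub>m a\<^sub>n \<rho> (Z n \<omega>) \<le> \<epsilon>\<^sub>n}"
  let ?B = "\<lambda>\<xi> \<rho>. {\<omega> \<in> space W. sinr_nm a\<^sub>m a\<^sub>n \<rho> (Z n \<omega>) > \<epsilon>\<^sub>m \<and> sinr_n \<xi> a\<^sub>n \<rho> (Z n \<omega>) (Y\<^sub>I \<omega>) \<le> \<epsilon>\<^sub>n}"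
  have meas: "?A1 \<rho> \<in> events" "?A2 \<rho> \<in> events" "?B \<xi> \<rho> \<in> events" for \<xi> \<rho>
    unfolding sinr_nm_def sinr_nn_def sinr_n_def by measurable
  \<comment> \<open>The two variants differ only in the first summand. Both lie between
    \<open>prob (?B \<xi> \<rho>)\<close> and the sum with \<open>?A1\<close>, so one argument
    treats them together.\<close>
  have Pn_cases: "P\<^sub>n \<xi> \<rho> = prob (?A1 \<rho>) + prob (?B \<xi> \<rho>) \<or> P\<^sub>n \<xi> \<rho> = prob (?A2 \<rho>) + prob (?B \<xi> \<rho>)"
    for \<xi> \<rho>
    using outage_user_n by (auto simp: outage_n1_def outage_n2_def)
  have A2_le: "prob (?A2 \<rho>) \<le> prob (?A1 \<rho>)" for \<rho>
    by (rule finite_measure_mono[OF _ meas(1)]) auto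
  have Pn_le: "P\<^sub>n \<xi> \<rho> \<le> prob (?A1 \<rho>) + prob (?B \<xi> \<rho>)" for \<xi> \<rho>
    using Pn_cases[of \<xi> \<rho>] A2_le[of \<rho>] by auto
  have Pn_ge: "prob (?B \<xi> \<rho>) \<le> P\<^sub>n \<xi> \<rho>" for \<xi> \<rho>
    using Pn_cases[of \<xi> \<rho>] by (auto simp: measure_nonneg)
  have le_1: "prob (?A1 \<rho>) + prob (?B \<xi> \<rho>) \<le> 1" for \<xi> \<rho>
    using meas by (intro prob_add_disjoint_le_1) auto
  have Pn01: "0 \<le> P\<^sub>n \<xi> \<rho>" "P\<^sub>n \<xi> \<rho> \<le> 1" for \<xi> \<rho>
    by (rule order_trans[OF measure_nonneg Pn_ge], rule order_trans[OF Pn_le le_1])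
  note pair = outage_pair_bounds[of P\<^sub>m _ "P\<^sub>n _", OF Pm01 Pn01]

  \<comment> \<open>Imperfect SIC: an error floor\<close>
  have imperfect: "has_diversity_order (outage_pair P\<^sub>m (P\<^sub>n 1)) 0"
  proof -
    obtain \<delta> where \<delta>: "\<delta> > 0" "prob {\<omega> \<in> space W. \<delta> \<le> Z n \<omega> \<and> Z n \<omega> \<le> u * Y\<^sub>I \<omega>} > 0" (is "?c > 0")
      using prob_interference_dominates[OF nM tu(2)] unfolding Zeq Yeq by blast
    \<comment> \<open>For such \<rho> a gain of at least \<delta> exceeds \<open>t / \<rho>\<close>,
      so the first SIC stage succeeds and the failure happens in the second.\<close>
    have bound: "?c \<le> outage_pair P\<^sub>m (P\<^sub>n 1) \<rho>" if \<rho>: "\<rho> > t / \<delta>" for \<rho>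
    proof -
      have "\<rho> > 0" using \<rho> tu(1) \<delta>(1) by (meson divide_pos_pos order_less_trans)
      have "t / \<rho> < \<delta>" using \<rho> \<delta>(1) \<open>\<rho> > 0\<close> by (simp add: field_simps)
      have "?c \<le> prob (?B 1 \<rho>)"
      proof (rule finite_measure_mono[OF _ meas(3)], clarify)
        fix \<omega> assume *: "\<delta> \<le> Z n \<omega>" "Z n \<omega> \<le> u * Y\<^sub>I \<omega>"
        have "sinr_nm a\<^sub>m a\<^sub>n \<rho> (Z n \<omega>) > \<epsilon>\<^sub>m"
          using sinr_nm_iff[OF \<open>\<rho> > 0\<close> Z0, of n \<omega>] * \<open>t / \<rho> < \<delta>\<close> by linarith
        moreover have "sinr_n 1 a\<^sub>n \<rho> (Z n \<omega>) (Y\<^sub>I \<omega>) \<le> \<epsilon>\<^sub>n"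
        proof -
          \<comment> \<open>Signal and interference both scale with \<rho>, so this comparison
            survives at every SNR; the noise term only adds slack.\<close>
          have "Z n \<omega> * a\<^sub>n \<le> \<epsilon>\<^sub>n * Y\<^sub>I \<omega>"
            using *(2) \<open>a\<^sub>n > 0\<close> by (simp add: u_def field_simps)
          then have "\<rho> * (Z n \<omega> * a\<^sub>n) \<le> \<rho> * (\<epsilon>\<^sub>n * Y\<^sub>I \<omega>)"
            using \<open>\<rho> > 0\<close> by (intro mult_left_mono) auto
          then have "\<rho> * Z n \<omega> * a\<^sub>n \<le> \<epsilon>\<^sub>n * (\<rho> * Y\<^sub>I \<omega> + 1)"
            using \<epsilon>(2) by (simp add: algebra_simps)
          moreover have "\<rho> * Y\<^sub>I \<omega> + 1 > 0" using Y0[of \<omega>] \<open>\<rho> > 0\<close> by (simp add: add_nonneg_pos)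
          ultimately show ?thesis by (simp add: sinr_n_def pos_divide_le_eq)
        qed
        ultimately show "\<epsilon>\<^sub>m < sinr_nm a\<^sub>m a\<^sub>n \<rho> (Z n \<omega>) \<and> sinr_n 1 a\<^sub>n \<rho> (Z n \<omega>) (Y\<^sub>I \<omega>) \<le> \<epsilon>\<^sub>n" ..
      qed
      also have "\<dots> \<le> P\<^sub>n 1 \<rho>" by (rule Pn_ge)
      also have "\<dots> \<le> outage_pair P\<^sub>m (P\<^sub>n 1) \<rho>" by (rule pair(2))
      finally show ?thesis .
    qed
    \<comment> \<open>The power equals 1 for positive \<rho>, whereas \<open>0 powr 0\<close> is
      0.\<close>
    have "eventually (\<lambda>\<rho>. ?c * \<rho> powr (- 0) \<le> outage_pair P\<^sub>m (P\<^sub>n 1) \<rho>) at_top"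
      using eventually_gt_at_top[of "t / \<delta>"] eventually_gt_at_top[of 0]
      by eventually_elim (use bound in simp)
    moreover have "eventually (\<lambda>\<rho>. outage_pair P\<^sub>m (P\<^sub>n 1) \<rho> \<le> 1 * \<rho> powr (- 0)) at_top"
      using eventually_gt_at_top[of 0] by eventually_elim (simp add: pair(3))
    ultimately show ?thesis by (rule has_diversity_orderI[OF \<delta>(2)])
  qed

  \<comment> \<open>Perfect SIC: decay governed by the weaker user\<close>
  have perfect: "has_diversity_order (outage_pair P\<^sub>m (P\<^sub>n 0)) (real (m * K))"
  proof -
    \<comment> \<open>\<open>T\<close> strictly exceeds both thresholds, so weak inequalities at
      \<open>t / \<rho>\<close> or \<open>u / \<rho>\<close> become strict at
      \<open>T / \<rho>\<close>.\<close>
    define T where "T = t + u"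
    define c where "c = (exp (-1) * (t / (\<eta> * K))) ^ (m * K)"
    \<comment> \<open>The factor 3 counts the outage of user m and the two failure events of user n;
      the rest is the tail bound at \<open>T / \<rho>\<close>.\<close>
    define C where "C = 3 * (2 ^ M * (T * (1 + R\<^sub>D powr \<alpha>) / \<eta>) ^ (m * K))"
    have T: "T > 0" "t < T" "u < T" using tu by (auto simp: T_def)
    have powr: "\<rho> powr (- real (m * K)) = (1 / \<rho>) ^ (m * K)" if "\<rho> > 0" for \<rho>
      using that by (simp add: powr_minus powr_realpow power_one_over inverse_eq_divide del: of_nat_mult)
    have "\<eta> * K > 0" using \<open>\<eta> > 0\<close> \<open>1 \<le> K\<close> by simp
    then have "c > 0" using tu by (simp add: c_def)
    moreover have "eventually (\<lambda>\<rho>. c * \<rho> powr (- real (m * K)) \<le> outage_pair P\<^sub>m (P\<^sub>n 0) \<rho>) at_top"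
      \<comment> \<open>The second threshold makes \<open>t / \<rho>\<close> small enough for the
        lower tail bound.\<close>
      using eventually_gt_at_top[of 0] eventually_gt_at_top[of "t / (\<eta> * K)"]
    proof eventually_elim
      case (elim \<rho>)
      have "c * \<rho> powr (- real (m * K)) = (exp (-1) * (t / \<rho> / (\<eta> * K))) ^ (m * K)"
        using elim by (simp only: powr c_def power_mult_distrib[symmetric]) (simp add: mult_ac)
      also have "\<dots> \<le> prob {\<omega> \<in> space W. ordered_gain m \<omega> < t / \<rho>}"
        using elim tu \<open>\<eta> * K > 0\<close> by (intro prob_ordered_gain_less_ge mM) (auto simp: field_simps)
      also have "\<dots> = P\<^sub>m \<rho>" using Pm_eq[OF elim(1)] by (simp add: Zeq)
      also have "\<dots> \<le> outage_pair P\<^sub>m (P\<^sub>n 0) \<rho>" by (rule pair(1))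
      finally show ?case .
    qed
    moreover have "eventually (\<lambda>\<rho>. outage_pair P\<^sub>m (P\<^sub>n 0) \<rho> \<le> C * \<rho> powr (- real (m * K))) at_top"
      using eventually_gt_at_top[of 0]
    proof eventually_elim
      case (elim \<rho>)
      let ?E = "{\<omega> \<in> space W. Z m \<omega> < T / \<rho>}"
      have E: "?E \<in> events" by measurable
      have less: "t / \<rho> < T / \<rho>" "u / \<rho> < T / \<rho>"
        using T elim by (auto simp: divide_strict_right_mono)
      have "P\<^sub>m \<rho> \<le> prob ?E"
        unfolding Pm_eq[OF elim] using less by (intro finite_measure_mono[OF _ E]) auto
      \<comment> \<open>As the m-th gain never exceeds the n-th, a failure of user n is also charged
        to a small m-th gain.\<close>
      moreover have "prob (?A1 \<rho>) \<le> prob ?E"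
      proof (rule finite_measure_mono[OF _ E], clarify)
        fix \<omega> assume "sinr_nm a\<^sub>m a\<^sub>n \<rho> (Z n \<omega>) \<le> \<epsilon>\<^sub>m"
        then show "Z m \<omega> < T / \<rho>"
          using sinr_nm_iff[OF elim Z0, of n \<omega>] Zmn[of \<omega>] less by linarith
      qed
      moreover have "prob (?B 0 \<rho>) \<le> prob ?E"
      proof (rule finite_measure_mono[OF _ E], clarify)
        fix \<omega> assume "sinr_n 0 a\<^sub>n \<rho> (Z n \<omega>) (Y\<^sub>I \<omega>) \<le> \<epsilon>\<^sub>n"
        then show "Z m \<omega> < T / \<rho>"
          using sinr_n_iff[OF elim Z0, of n \<omega>] Zmn[of \<omega>] less by fastforce
      qed
      ultimately have "outage_pair P\<^sub>m (P\<^sub>n 0) \<rho> \<le> 3 * prob ?E"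
        using pair(4)[of 0 \<rho>] Pn_le[of 0 \<rho>] by linarith
      also have "prob ?E \<le> 2 ^ M * (T / \<rho> * (1 + R\<^sub>D powr \<alpha>) / \<eta>) ^ (m * K)"
        unfolding Zeq using T elim by (intro prob_ordered_gain_less_le mM) auto
      also have "3 * \<dots> = C * \<rho> powr (- real (m * K))"
        using elim by (simp only: powr C_def mult.assoc power_mult_distrib[symmetric]) (simp add: mult_ac)
      finally show ?case by simp
    qed
    ultimately show ?thesis by (rule has_diversity_orderI)
  qed
  show ?thesis using imperfect perfect by auto
qed

end
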